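(* Let $G$ be a finite connected simple graph with vertex set $V$ and automorphism group $\Gamma$, and let $R$ be a complete set of representatives of the unlabeled imbeddings of $G$. Let $Y$ be a set, each element $y\in Y$ having a weight $\mathrm{wt}(y)=(p_1,\dots,p_n)\in\mathbb{Z}_{\ge 0}^n$, with finitely many elements of each weight, and let $f(w_1,\dots,w_n)=\sum_{y\in Y} w_1^{p_1(y)}\cdots w_n^{p_n(y)}$ be the figure counting series. For a function $c:V\to Y$ define its weight $W(c)=\prod_{v\in V} w_1^{p_1(c(v))}\cdots w_n^{p_n(c(v))}$. For each $M\in R$, the group $\Gamma_M(G)$ acts on the functions $V\to Y$ by $(\gamma c)(v)=c(\gamma^{-1}(v))$; the orbits are the configurations of $M$, and $W$ is constant on each configuration. Then \[ Z(G;f(w_1,\dots,w_n))=\sum_{M\in R}\ \sum_{\text{configurations } C \text{ of } M} W(C), \] i.e. $Z(G;f)$ enumerates by weight the configurations of $G$ among its unlabeled imbeddings. Here $Z(G;f(w_1,\dots,w_n))$ denotes the result of substituting $s_k\mapsto f(w_1^k,\dots,w_n^k)$ for every $k$ in the imbedding sum $Z(G)$.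
   Context: For a vertex $v$, $N(v)$ is the set of vertices adjacent to $v$. A rotation at $v$ is a cyclic permutation $\rho_v:N(v)\to N(v)$ (a single cycle through all of $N(v)$). A rotation system is an indexed family $\rho=\{\rho_v\}_{v\in V}$ of rotations, and a map is a pair $M=(G,\rho)$. The automorphism group $\Gamma=\Gamma(G)$ acts on maps: $\gamma$ sends $(G,\rho)$ to $(G,\rho')$ with $\rho'_{\gamma(v)}=\gamma\rho_v\gamma^{-1}$ for all $v$. The map-automorphism group $\Gamma_M(G)$ is the stabilizer of $M$; the $\Gamma$-orbits of maps are the unlabeled imbeddings. $F(\gamma)$ is the set of maps fixed by $\gamma$. For a permutation $\gamma$ of $V$, $s(\gamma)=\prod_k s_k^{j_k}$ where $j_k$ is the number of $k$-cycles of $\gamma$ on $V$. The imbedding sum is $Z(G)=\frac{1}{|\Gamma|}\sum_{\gamma\in\Gamma}|F(\gamma)|\,s(\gamma)$. *)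

theory Defs
  imports
    "HOL-Library.Poly_Mapping"
    "HOL-Combinatorics.Orbits"
    "HOL-Algebra.Group_Action"
    "HOL-Analysis.Finite_Cartesian_Product"
    "Graph_Theory.Digraph_Component"
begin

section \<open>Formal power series in the variables \<open>w\<^sub>i\<close>, \<open>i :: 'n\<close>\<close>

text \<open>
  Exponent vectors are elements of \<open>nat ^ 'n\<close>, so that the number of variables is
  \<open>CARD('n)\<close>. A series is its family of coefficients.
\<close>

typedef (overloaded) ('a, 'n::finite) mfps = "UNIV :: (nat ^ 'n \<Rightarrow> 'a) set"
  morphisms mfps_nth Abs_mfps ..

setup_lifting type_definition_mfps

lemma mfps_eqI: "(\<And>e. mfps_nth F e = mfps_nth H e) \<Longrightarrow> F = H"
  by transfer auto

lemma mfps_nth_Abs [simp]: "mfps_nth (Abs_mfps F) e = F e"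
  by (simp add: Abs_mfps_inverse)

definition exp_splits :: "nat ^ 'n \<Rightarrow> ((nat ^ 'n) \<times> (nat ^ 'n)) set" where
  "exp_splits e = {(a, b). a + b = e}"

lemma finite_exp_splits [simp]: "finite (exp_splits (e :: nat ^ 'n))"
proof -
  let ?B = "(\<lambda>h. \<chi> i. h i) ` (UNIV \<rightarrow>\<^sub>E {..Max (range (($) e))}) :: (nat ^ 'n) set"
  have mem: "a \<in> ?B" if "a \<le> e" for a :: "nat ^ 'n"
  proof (rule image_eqI)
    show "a = (\<chi> i. a $ i)" by (simp add: vec_eq_iff)
    have "a $ i \<le> Max (range (($) e))" for i
      using that by (meson Max_ge finite finite_imageI less_eq_vec_def order_trans rangeI)
    then show "($) a \<in> UNIV \<rightarrow>\<^sub>E {..Max (range (($) e))}" by auto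
  qed
  have "exp_splits e \<subseteq> ?B \<times> ?B"
  proof
    fix p assume "p \<in> exp_splits e"
    then obtain a b where p: "p = (a, b)" "a + b = e" by (auto simp: exp_splits_def)
    then have "a \<le> e" "b \<le> e" by (auto simp: less_eq_vec_def)
    then show "p \<in> ?B \<times> ?B" using mem p by blast
  qed
  moreover have "finite ?B" by (intro finite_imageI finite_PiE) auto
  ultimately show ?thesis by (meson finite_SigmaI finite_subset)
qed

instantiation mfps :: (comm_ring_1, finite) comm_ring_1
begin

definition "0 = Abs_mfps (\<lambda>_. 0)"
definition "1 = Abs_mfps (\<lambda>e. if e = 0 then 1 else 0)"
definition "F + H = Abs_mfps (\<lambda>e. mfps_nth F e + mfps_nth H e)"
definition "F - H = Abs_mfps (\<lambda>e. mfps_nth F e - mfps_nth H e)"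
definition "- F = Abs_mfps (\<lambda>e. - mfps_nth F e)"
definition "F * H = Abs_mfps (\<lambda>e. \<Sum>(a, b)\<in>exp_splits e. mfps_nth F a * mfps_nth H b)"

instance
proof
  fix F H K :: "('a, 'b) mfps"
  show "F * H * K = F * (H * K)"
  proof (rule mfps_eqI)
    fix e :: "nat ^ 'b"
    have "mfps_nth (F * H * K) e =
        (\<Sum>(x, c)\<in>exp_splits e. \<Sum>(a, b)\<in>exp_splits x. mfps_nth F a * mfps_nth H b * mfps_nth K c)"
      by (simp add: times_mfps_def sum_distrib_right case_prod_unfold)
    also have "\<dots> = (\<Sum>(p, q)\<in>Sigma (exp_splits e) (\<lambda>p. exp_splits (fst p)).
        mfps_nth F (fst q) * mfps_nth H (snd q) * mfps_nth K (snd p))"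
      by (simp add: sum.Sigma case_prod_unfold)
    also have "\<dots> = (\<Sum>(p, q)\<in>Sigma (exp_splits e) (\<lambda>p. exp_splits (snd p)).
        mfps_nth F (fst p) * mfps_nth H (fst q) * mfps_nth K (snd q))"
      by (rule sum.reindex_bij_witness
          [where i = "\<lambda>((a, x), (b, c)). ((a + b, c), (a, b))"
             and j = "\<lambda>((x, c), (a, b)). ((a, b + c), (b, c))"])
         (auto simp: exp_splits_def add.assoc)
    also have "\<dots> = (\<Sum>(a, x)\<in>exp_splits e. \<Sum>(b, c)\<in>exp_splits x.
        mfps_nth F a * mfps_nth H b * mfps_nth K c)"
      by (simp add: sum.Sigma case_prod_unfold)
    also have "\<dots> = mfps_nth (F * (H * K)) e"
      by (simp add: times_mfps_def sum_distrib_left case_prod_unfold mult.assoc)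
    finally show "mfps_nth (F * H * K) e = mfps_nth (F * (H * K)) e" .
  qed
  show "F * H = H * F"
  proof (rule mfps_eqI)
    fix e :: "nat ^ 'b"
    show "mfps_nth (F * H) e = mfps_nth (H * F) e"
      unfolding times_mfps_def mfps_nth_Abs
      by (rule sum.reindex_bij_witness[where i = prod.swap and j = prod.swap])
         (auto simp: exp_splits_def add.commute mult.commute)
  qed
  show "1 * F = F"
  proof (rule mfps_eqI)
    fix e :: "nat ^ 'b"
    have "mfps_nth (1 * F) e = (\<Sum>p\<in>exp_splits e. if p = (0, e) then mfps_nth F e else 0)"
      unfolding times_mfps_def one_mfps_def mfps_nth_Abs
      by (rule sum.cong) (auto simp: exp_splits_def split: if_splits)
    also have "\<dots> = mfps_nth F e"
      by (subst sum.delta, simp) (simp add: exp_splits_def)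
    finally show "mfps_nth (1 * F) e = mfps_nth F e" .
  qed
  show "(F + H) * K = F * K + H * K"
    by (rule mfps_eqI)
       (simp add: times_mfps_def plus_mfps_def sum.distrib case_prod_unfold algebra_simps)
  show "(0 :: ('a, 'b) mfps) \<noteq> 1"
  proof
    assume "(0 :: ('a, 'b) mfps) = 1"
    then have "mfps_nth (0 :: ('a, 'b) mfps) 0 = mfps_nth 1 0" by (rule arg_cong)
    then show False by (simp add: zero_mfps_def one_mfps_def)
  qed
qed (auto intro!: mfps_eqI simp: zero_mfps_def plus_mfps_def minus_mfps_def uminus_mfps_def)

end

definition mfps_const :: "'a::zero \<Rightarrow> ('a, 'n::finite) mfps" where
  "mfps_const a = Abs_mfps (\<lambda>e. if e = 0 then a else 0)"

definition mfps_var :: "'n::finite \<Rightarrow> ('a::zero_neq_one, 'n) mfps" where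
  "mfps_var i = Abs_mfps (\<lambda>e. if e = axis i 1 then 1 else 0)"

definition mfps_monom :: "nat ^ 'n::finite \<Rightarrow> ('a::comm_ring_1, 'n) mfps" where
  "mfps_monom p = (\<Prod>i\<in>UNIV. mfps_var i ^ (p $ i))"

lemma mfps_monom_mult:
  "Abs_mfps (\<lambda>e. if e = p then 1 else 0) * Abs_mfps (\<lambda>e. if e = q then 1 else 0) =
   (Abs_mfps (\<lambda>e. if e = p + q then 1 else 0) :: ('a::comm_ring_1, 'n::finite) mfps)"
proof (rule mfps_eqI)
  fix e :: "nat ^ 'n"
  have "(\<Sum>(a, b)\<in>exp_splits e. (if a = p then 1 else 0) * (if b = q then 1 else 0)) =
      (\<Sum>x\<in>exp_splits e. if x = (p, q) then 1 else (0::'a))"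
    by (rule sum.cong) (auto split: if_splits)
  also have "\<dots> = (if e = p + q then 1 else 0)"
    by (subst sum.delta, simp) (auto simp: exp_splits_def)
  finally show "mfps_nth (Abs_mfps (\<lambda>e. if e = p then 1 else 0) *
      Abs_mfps (\<lambda>e. if e = q then 1 else 0)) e =
      mfps_nth (Abs_mfps (\<lambda>e. if e = p + q then 1 else (0::'a))) e"
    by (simp add: times_mfps_def)
qed

lemma mfps_var_power:
  "(mfps_var i :: ('a::comm_ring_1, 'n::finite) mfps) ^ k =
     Abs_mfps (\<lambda>e. if e = axis i k then 1 else 0)"
proof (induction k)
  case 0
  have "axis i (0::nat) = (0 :: nat ^ 'n)" by (simp add: axis_def vec_eq_iff)
  from this[symmetric] show ?case by (simp add: one_mfps_def del: axis_eq_0_iff)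
next
  case (Suc k)
  have "axis i (1::nat) + axis i k = (axis i (Suc k) :: nat ^ 'n)"
    by (simp add: axis_def vec_eq_iff)
  then show ?case by (simp add: Suc mfps_monom_mult) (simp add: mfps_var_def mfps_monom_mult)
qed

lemma mfps_nth_monom:
  "mfps_nth (mfps_monom p :: ('a::comm_ring_1, 'n::finite) mfps) e = (if e = p then 1 else 0)"
proof -
  have "(\<Prod>i\<in>A. mfps_var i ^ (p $ i)) =
      (Abs_mfps (\<lambda>e. if e = (\<Sum>i\<in>A. axis i (p $ i)) then 1 else 0) :: ('a, 'n) mfps)"
    if "finite A" for A
    using that
    by induction (simp_all add: one_mfps_def mfps_var_power mfps_monom_mult)
  moreover have "(\<Sum>i\<in>UNIV. axis i (p $ i)) = p"
    by (simp add: vec_eq_iff axis_def if_distrib cong: if_cong)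
  ultimately show ?thesis by (simp add: mfps_monom_def)
qed

text \<open>
  Possibly infinite formal sums: a family is summable if only finitely many of its members
  contribute to any given coefficient.
\<close>

definition mfps_summable :: "('b \<Rightarrow> ('a::comm_ring_1, 'n::finite) mfps) \<Rightarrow> 'b set \<Rightarrow> bool" where
  "mfps_summable F B \<longleftrightarrow> (\<forall>e. finite {b \<in> B. mfps_nth (F b) e \<noteq> 0})"

definition mfps_sum :: "('b \<Rightarrow> ('a::comm_ring_1, 'n::finite) mfps) \<Rightarrow> 'b set \<Rightarrow> ('a, 'n) mfps" where
  "mfps_sum F B = Abs_mfps (\<lambda>e. \<Sum>b | b \<in> B \<and> mfps_nth (F b) e \<noteq> 0. mfps_nth (F b) e)"

text \<open>
  The series \<open>F(w\<^sub>1\<^sup>k, \<dots>, w\<^sub>n\<^sup>k)\<close>, for \<open>k \<ge> 1\<close>: the monomial with exponent vector \<open>d\<close> becomes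
  the one with exponent vector \<open>k *s d\<close>. The sum below then has at most one term.
\<close>

definition mfps_subst_power :: "nat \<Rightarrow> ('a::comm_ring_1, 'n::finite) mfps \<Rightarrow> ('a, 'n) mfps" where
  "mfps_subst_power k F = Abs_mfps (\<lambda>e. \<Sum>d | k *s d = e. mfps_nth F d)"


section \<open>Polynomials in the indeterminates \<open>s\<^sub>k\<close>, \<open>k :: nat\<close>\<close>

type_synonym 'a cpoly = "(nat \<Rightarrow>\<^sub>0 nat) \<Rightarrow>\<^sub>0 'a"

definition cpoly_const :: "'a::zero \<Rightarrow> 'a cpoly" where
  "cpoly_const a = Poly_Mapping.single 0 a"

definition cpoly_var :: "nat \<Rightarrow> 'a::comm_ring_1 cpoly" where
  "cpoly_var k = Poly_Mapping.single (Poly_Mapping.single k 1) 1"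

definition cpoly_subst ::
  "(nat \<Rightarrow> ('a::comm_ring_1, 'n::finite) mfps) \<Rightarrow> 'a cpoly \<Rightarrow> ('a, 'n) mfps" where
  "cpoly_subst \<sigma> P =
     (\<Sum>m\<in>Poly_Mapping.keys P. mfps_const (Poly_Mapping.lookup P m) *
        (\<Prod>k\<in>Poly_Mapping.keys m. \<sigma> k ^ Poly_Mapping.lookup m k))"


section \<open>Maps and their automorphisms\<close>

text \<open>
  Finite simple graphs are \<^locale>\<open>pair_graph\<close>s: an edge \<open>uv\<close> is the pair of arcs \<open>(u, v)\<close>
  and \<open>(v, u)\<close>.
\<close>

definition nbrs :: "'v pair_pre_digraph \<Rightarrow> 'v \<Rightarrow> 'v set" where
  "nbrs G v = {u. (v, u) \<in> parcs G}"

text \<open>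
  \<^const>\<open>cyclic_on\<close> fails for the empty set; the isolated vertex of the one-vertex graph is given
  its unique (empty) rotation.
\<close>

definition rotation :: "'v pair_pre_digraph \<Rightarrow> 'v \<Rightarrow> ('v \<Rightarrow> 'v) \<Rightarrow> bool" where
  "rotation G v r \<longleftrightarrow> r permutes nbrs G v \<and> (nbrs G v = {} \<or> cyclic_on r (nbrs G v))"

text \<open>As \<open>G\<close> is fixed, a map \<open>(G, \<rho>)\<close> is represented by its rotation system \<open>\<rho>\<close>.\<close>

definition graph_maps :: "'v pair_pre_digraph \<Rightarrow> ('v \<Rightarrow> 'v \<Rightarrow> 'v) set" where
  "graph_maps G = (\<Pi>\<^sub>E v\<in>pverts G. {r. rotation G v r})"

definition aut_group :: "'v pair_pre_digraph \<Rightarrow> ('v \<Rightarrow> 'v) monoid" where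
  "aut_group G =
     \<lparr>carrier = {\<gamma>. \<gamma> permutes pverts G \<and>
        (\<forall>u\<in>pverts G. \<forall>v\<in>pverts G. (\<gamma> u, \<gamma> v) \<in> parcs G \<longleftrightarrow> (u, v) \<in> parcs G)},
      mult = (\<circ>), one = id\<rparr>"

text \<open>
  The defining equation \<open>\<rho>'\<^sub>\<gamma>\<^sub>(\<^sub>u\<^sub>) = \<gamma> \<rho>\<^sub>u \<gamma>\<^sup>-\<^sup>1\<close> is read at \<open>u = \<gamma>\<^sup>-\<^sup>1 v\<close>.
\<close>

definition map_action :: "'v pair_pre_digraph \<Rightarrow> ('v \<Rightarrow> 'v) \<Rightarrow> ('v \<Rightarrow> 'v \<Rightarrow> 'v) \<Rightarrow> 'v \<Rightarrow> 'v \<Rightarrow> 'v" where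
  "map_action G \<gamma> =
     (\<lambda>\<rho>\<in>graph_maps G. \<lambda>v\<in>pverts G.
        \<gamma> \<circ> \<rho> (Hilbert_Choice.inv \<gamma> v) \<circ> Hilbert_Choice.inv \<gamma>)"

definition unlabeled_imbeddings :: "'v pair_pre_digraph \<Rightarrow> ('v \<Rightarrow> 'v \<Rightarrow> 'v) set set" where
  "unlabeled_imbeddings G = orbits (aut_group G) (graph_maps G) (map_action G)"

definition complete_representatives :: "'v pair_pre_digraph \<Rightarrow> ('v \<Rightarrow> 'v \<Rightarrow> 'v) set \<Rightarrow> bool" where
  "complete_representatives G R \<longleftrightarrow>
     R \<subseteq> graph_maps G \<and> (\<forall>I\<in>unlabeled_imbeddings G. \<exists>!M. M \<in> I \<and> M \<in> R)"

definition map_aut_group :: "'v pair_pre_digraph \<Rightarrow> ('v \<Rightarrow> 'v \<Rightarrow> 'v) \<Rightarrow> ('v \<Rightarrow> 'v) monoid" where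
  "map_aut_group G M = (aut_group G)\<lparr>carrier := stabilizer (aut_group G) (map_action G) M\<rparr>"

definition fixed_maps :: "'v pair_pre_digraph \<Rightarrow> ('v \<Rightarrow> 'v) \<Rightarrow> ('v \<Rightarrow> 'v \<Rightarrow> 'v) set" where
  "fixed_maps G \<gamma> = invariants (graph_maps G) (map_action G) \<gamma>"


section \<open>The imbedding sum\<close>

text \<open>
  A cycle of \<open>\<gamma>\<close> on \<open>V\<close> is identified with its set of points; fixed points count as 1-cycles.
\<close>

definition num_cycles :: "'v set \<Rightarrow> ('v \<Rightarrow> 'v) \<Rightarrow> nat \<Rightarrow> nat" where
  "num_cycles V \<gamma> k = card {C \<in> Orbits.orbit \<gamma> ` V. card C = k}"

definition cycle_monom :: "'v set \<Rightarrow> ('v \<Rightarrow> 'v) \<Rightarrow> rat cpoly" where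
  "cycle_monom V \<gamma> = (\<Prod>k = 1..card V. cpoly_var k ^ num_cycles V \<gamma> k)"

definition imbedding_sum :: "'v pair_pre_digraph \<Rightarrow> rat cpoly" where
  "imbedding_sum G =
     cpoly_const (1 / of_nat (order (aut_group G))) *
     (\<Sum>\<gamma>\<in>carrier (aut_group G). of_nat (card (fixed_maps G \<gamma>)) * cycle_monom (pverts G) \<gamma>)"


section \<open>Configurations\<close>

definition figure_series :: "'y set \<Rightarrow> ('y \<Rightarrow> nat ^ 'n::finite) \<Rightarrow> (rat, 'n) mfps" where
  "figure_series Y wt = mfps_sum (\<lambda>y. mfps_monom (wt y)) Y"

definition colorings :: "'v pair_pre_digraph \<Rightarrow> 'y set \<Rightarrow> ('v \<Rightarrow> 'y) set" where
  "colorings G Y = pverts G \<rightarrow>\<^sub>E Y"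

definition color_action ::
  "'v pair_pre_digraph \<Rightarrow> 'y set \<Rightarrow> ('v \<Rightarrow> 'v) \<Rightarrow> ('v \<Rightarrow> 'y) \<Rightarrow> 'v \<Rightarrow> 'y" where
  "color_action G Y \<gamma> = (\<lambda>c\<in>colorings G Y. \<lambda>v\<in>pverts G. c (Hilbert_Choice.inv \<gamma> v))"

lemma group_actionI:
  assumes G: "group G"
    and ext: "\<And>g. g \<in> carrier G \<Longrightarrow> \<phi> g \<in> E \<rightarrow>\<^sub>E E"
    and one: "\<And>x. x \<in> E \<Longrightarrow> \<phi> \<one>\<^bsub>G\<^esub> x = x"
    and mult: "\<And>g h x. g \<in> carrier G \<Longrightarrow> h \<in> carrier G \<Longrightarrow> x \<in> E \<Longrightarrow>
                 \<phi> (g \<otimes>\<^bsub>G\<^esub> h) x = \<phi> g (\<phi> h x)"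
  shows "group_action G E \<phi>"
proof -
  interpret group G by fact
  have bij: "\<phi> g \<in> Bij E" if g: "g \<in> carrier G" for g
  proof -
    have "bij_betw (\<phi> g) E E"
    proof (rule bij_betw_byWitness[where f' = "\<phi> (inv\<^bsub>G\<^esub> g)"])
      show "\<forall>a\<in>E. \<phi> (inv\<^bsub>G\<^esub> g) (\<phi> g a) = a" "\<forall>a\<in>E. \<phi> g (\<phi> (inv\<^bsub>G\<^esub> g) a) = a"
        using g mult[symmetric] one by auto
      show "\<phi> g ` E \<subseteq> E" "\<phi> (inv\<^bsub>G\<^esub> g) ` E \<subseteq> E"
        using ext[OF g] ext[OF inv_closed[OF g]] by auto
    qed
    then show ?thesis using ext[OF g] by (auto simp: Bij_def PiE_def)
  qed
  have "\<phi> \<in> hom G (BijGroup E)"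
  proof (rule homI)
    fix g h assume gh: "g \<in> carrier G" "h \<in> carrier G"
    show "\<phi> (g \<otimes>\<^bsub>G\<^esub> h) = \<phi> g \<otimes>\<^bsub>BijGroup E\<^esub> \<phi> h"
    proof
      fix x
      show "\<phi> (g \<otimes>\<^bsub>G\<^esub> h) x = (\<phi> g \<otimes>\<^bsub>BijGroup E\<^esub> \<phi> h) x"
        using gh bij mult ext[OF m_closed[OF gh]]
        by (cases "x \<in> E") (auto simp: BijGroup_def compose_def PiE_def extensional_def)
    qed
  qed (use bij in \<open>auto simp: BijGroup_def\<close>)
  then show ?thesis
    unfolding group_action_def group_hom_def group_hom_axioms_def
    using group_BijGroup G by blast
qed

lemma permutes_pverts: "\<gamma> \<in> carrier (aut_group G) \<Longrightarrow> \<gamma> permutes pverts G"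
  by (simp add: aut_group_def)

lemma group_aut_group: "group (aut_group G)"
proof (rule groupI)
  fix g assume "g \<in> carrier (aut_group G)"
  then have g: "g permutes pverts G"
     and e: "\<And>u v. u \<in> pverts G \<Longrightarrow> v \<in> pverts G \<Longrightarrow> (g u, g v) \<in> parcs G \<longleftrightarrow> (u, v) \<in> parcs G"
    by (auto simp: aut_group_def)
  let ?h = "Hilbert_Choice.inv g"
  have "?h permutes pverts G" using g by (rule permutes_inv)
  moreover have "(?h u, ?h v) \<in> parcs G \<longleftrightarrow> (u, v) \<in> parcs G"
    if "u \<in> pverts G" "v \<in> pverts G" for u v
    using e[of "?h u" "?h v"] that g \<open>?h permutes _\<close>
    by (simp add: permutes_in_image permutes_inverses)
  ultimately show "\<exists>y\<in>carrier (aut_group G). y \<otimes>\<^bsub>aut_group G\<^esub> g = \<one>\<^bsub>aut_group G\<^esub>"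
    using g by (intro bexI[of _ ?h]) (auto simp: aut_group_def permutes_inv_o)
qed (auto simp: aut_group_def permutes_compose permutes_id o_assoc permutes_in_image)

lemma orbit_conj:
  assumes "\<gamma> permutes V"
  shows "Orbits.orbit (\<gamma> \<circ> r \<circ> Hilbert_Choice.inv \<gamma>) (\<gamma> x) = \<gamma> ` Orbits.orbit r x"
proof -
  have "(\<gamma> \<circ> r \<circ> Hilbert_Choice.inv \<gamma>) ^^ n = \<gamma> \<circ> r ^^ n \<circ> Hilbert_Choice.inv \<gamma>" for n
    using assms by (induction n) (auto simp: fun_eq_iff permutes_inverses)
  then show ?thesis
    using assms by (auto simp: orbit_altdef permutes_inverses)
qed

lemma nbrs_aut:
  assumes "pair_graph G" "\<gamma> \<in> carrier (aut_group G)" "v \<in> pverts G"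
  shows "nbrs G (\<gamma> v) = \<gamma> ` nbrs G v"
proof -
  interpret pair_graph G by fact
  have g: "\<gamma> permutes pverts G"
     and e: "\<And>u v. u \<in> pverts G \<Longrightarrow> v \<in> pverts G \<Longrightarrow> (\<gamma> u, \<gamma> v) \<in> parcs G \<longleftrightarrow> (u, v) \<in> parcs G"
    using assms(2) by (auto simp: aut_group_def)
  show ?thesis
  proof (intro equalityI subsetI)
    fix u assume u: "u \<in> nbrs G (\<gamma> v)"
    then have "u \<in> pverts G" by (auto simp: nbrs_def dest: in_arcsD2)
    then have "Hilbert_Choice.inv \<gamma> u \<in> pverts G"
      using permutes_inv[OF g] by (simp add: permutes_in_image)
    then have "Hilbert_Choice.inv \<gamma> u \<in> nbrs G v"
      using u e[of v "Hilbert_Choice.inv \<gamma> u"] assms(3) g by (simp add: nbrs_def permutes_inverses)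
    then show "u \<in> \<gamma> ` nbrs G v"
      by (rule rev_image_eqI) (use g in \<open>simp add: permutes_inverses\<close>)
  next
    fix u assume "u \<in> \<gamma> ` nbrs G v"
    then obtain w where "u = \<gamma> w" "(v, w) \<in> parcs G" by (auto simp: nbrs_def)
    then show "u \<in> nbrs G (\<gamma> v)" using e[of v w] assms(3) by (auto simp: nbrs_def dest: in_arcsD2)
  qed
qed

lemma rotation_conj:
  assumes "pair_graph G" "\<gamma> \<in> carrier (aut_group G)" "v \<in> pverts G" "rotation G v r"
  shows "rotation G (\<gamma> v) (\<gamma> \<circ> r \<circ> Hilbert_Choice.inv \<gamma>)"
proof -
  have g: "\<gamma> permutes pverts G" using assms(2) by (rule permutes_pverts)
  have N: "nbrs G (\<gamma> v) = \<gamma> ` nbrs G v" using assms by (intro nbrs_aut)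
  have r: "r permutes nbrs G v" using assms(4) by (simp add: rotation_def)
  have "(\<gamma> \<circ> r \<circ> Hilbert_Choice.inv \<gamma>) permutes \<gamma> ` nbrs G v"
  proof (rule bij_imp_permutes)
    have "bij (\<gamma> \<circ> r \<circ> Hilbert_Choice.inv \<gamma>)"
      using g r by (meson bij_comp permutes_bij permutes_inv)
    moreover have "(\<gamma> \<circ> r \<circ> Hilbert_Choice.inv \<gamma>) ` \<gamma> ` nbrs G v = \<gamma> ` nbrs G v"
      using permutes_image[OF r] g
      by (metis (no_types, lifting) image_comp comp_assoc comp_id permutes_inv_o(2))
    ultimately show "bij_betw (\<gamma> \<circ> r \<circ> Hilbert_Choice.inv \<gamma>) (\<gamma> ` nbrs G v) (\<gamma> ` nbrs G v)"
      by (metis bij_betw_def bij_is_inj inj_on_subset subset_UNIV)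
    fix x assume x: "x \<notin> \<gamma> ` nbrs G v"
    then have "Hilbert_Choice.inv \<gamma> x \<notin> nbrs G v"
      using g by (metis image_eqI permutes_inverses(1))
    then have "r (Hilbert_Choice.inv \<gamma> x) = Hilbert_Choice.inv \<gamma> x" using r by (simp add: permutes_def)
    then show "(\<gamma> \<circ> r \<circ> Hilbert_Choice.inv \<gamma>) x = x" using g by (simp add: permutes_inverses)
  qed
  moreover have "cyclic_on (\<gamma> \<circ> r \<circ> Hilbert_Choice.inv \<gamma>) (\<gamma> ` nbrs G v)" if "cyclic_on r (nbrs G v)"
    using that orbit_conj[OF g, of r] unfolding cyclic_on_def by (metis image_eqI)
  ultimately show ?thesis using assms(4) N by (auto simp: rotation_def)
qed

lemma group_action_maps:
  assumes "pair_graph G"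
  shows "group_action (aut_group G) (graph_maps G) (map_action G)"
proof (rule group_actionI[OF group_aut_group])
  show cl: "map_action G g \<in> graph_maps G \<rightarrow>\<^sub>E graph_maps G" if g: "g \<in> carrier (aut_group G)" for g
  proof (rule PiE_I)
    fix \<rho> assume \<rho>: "\<rho> \<in> graph_maps G"
    have p: "g permutes pverts G" using g by (rule permutes_pverts)
    have "rotation G v (g \<circ> \<rho> (Hilbert_Choice.inv g v) \<circ> Hilbert_Choice.inv g)"
      if v: "v \<in> pverts G" for v
    proof -
      have "Hilbert_Choice.inv g v \<in> pverts G"
        using v permutes_inv[OF p] by (simp add: permutes_in_image)
      moreover have "rotation G (Hilbert_Choice.inv g v) (\<rho> (Hilbert_Choice.inv g v))"
        using calculation \<rho> by (auto simp: graph_maps_def)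
      ultimately show ?thesis
        using rotation_conj[OF assms g, of "Hilbert_Choice.inv g v"] p
        by (simp add: permutes_inverses)
    qed
    then show "map_action G g \<rho> \<in> graph_maps G"
      using \<rho> by (auto simp: map_action_def graph_maps_def)
  qed (simp add: map_action_def)
  show "map_action G \<one>\<^bsub>aut_group G\<^esub> \<rho> = \<rho>" if "\<rho> \<in> graph_maps G" for \<rho>
    using that by (auto simp: map_action_def aut_group_def graph_maps_def fun_eq_iff PiE_def extensional_def inv_id)
  fix g h \<rho>
  assume gh: "g \<in> carrier (aut_group G)" "h \<in> carrier (aut_group G)" and \<rho>: "\<rho> \<in> graph_maps G"
  have p: "g permutes pverts G" "h permutes pverts G" using gh by (auto intro: permutes_pverts)
  have *: "Hilbert_Choice.inv (g \<circ> h) = Hilbert_Choice.inv h \<circ> Hilbert_Choice.inv g"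
    using p by (meson o_inv_distrib permutes_bij)
  have **: "Hilbert_Choice.inv g v \<in> pverts G" if "v \<in> pverts G" for v
    using that permutes_inv[OF p(1)] by (simp add: permutes_in_image)
  have "map_action G h \<rho> \<in> graph_maps G" using cl[OF gh(2)] \<rho> by auto
  then show "map_action G (g \<otimes>\<^bsub>aut_group G\<^esub> h) \<rho> = map_action G g (map_action G h \<rho>)"
    using \<rho> ** by (auto simp: map_action_def aut_group_def * fun_eq_iff)
qed

lemma group_action_colorings: "group_action (aut_group G) (colorings G Y) (color_action G Y)"
proof (rule group_actionI[OF group_aut_group])
  have in_verts: "Hilbert_Choice.inv g v \<in> pverts G"
    if "g \<in> carrier (aut_group G)" "v \<in> pverts G" for g v
    using that permutes_inv[OF permutes_pverts[OF that(1)]] by (simp add: permutes_in_image)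
  show cl: "color_action G Y g \<in> colorings G Y \<rightarrow>\<^sub>E colorings G Y"
    if g: "g \<in> carrier (aut_group G)" for g
    using in_verts[OF g] by (auto simp: color_action_def colorings_def)
  show "color_action G Y \<one>\<^bsub>aut_group G\<^esub> c = c" if "c \<in> colorings G Y" for c
    using that by (auto simp: color_action_def aut_group_def colorings_def fun_eq_iff PiE_def extensional_def inv_id)
  fix g h c
  assume gh: "g \<in> carrier (aut_group G)" "h \<in> carrier (aut_group G)" and c: "c \<in> colorings G Y"
  have *: "Hilbert_Choice.inv (g \<circ> h) = Hilbert_Choice.inv h \<circ> Hilbert_Choice.inv g"
    using gh by (meson o_inv_distrib permutes_bij permutes_pverts)
  have "color_action G Y h c \<in> colorings G Y" using cl[OF gh(2)] c by auto
  then show "color_action G Y (g \<otimes>\<^bsub>aut_group G\<^esub> h) c = color_action G Y g (color_action G Y h c)"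
    using c in_verts[OF gh(1)] by (auto simp: color_action_def aut_group_def * fun_eq_iff)
qed

definition configurations ::
  "'v pair_pre_digraph \<Rightarrow> 'y set \<Rightarrow> ('v \<Rightarrow> 'v \<Rightarrow> 'v) \<Rightarrow> ('v \<Rightarrow> 'y) set set" where
  "configurations G Y M = orbits (map_aut_group G M) (colorings G Y) (color_action G Y)"

definition color_weight ::
  "'v pair_pre_digraph \<Rightarrow> ('y \<Rightarrow> nat ^ 'n::finite) \<Rightarrow> ('v \<Rightarrow> 'y) \<Rightarrow> (rat, 'n) mfps" where
  "color_weight G wt c = (\<Prod>v\<in>pverts G. mfps_monom (wt (c v)))"

text \<open>The common value of the weight on \<open>C\<close>.\<close>

definition config_weight ::
  "'v pair_pre_digraph \<Rightarrow> ('y \<Rightarrow> nat ^ 'n::finite) \<Rightarrow> ('v \<Rightarrow> 'y) set \<Rightarrow> (rat, 'n) mfps" where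
  "config_weight G wt C = the_elem (color_weight G wt ` C)"

end

theory Submission
  imports Defs
begin

text \<open>
  Compare coefficients of a monomial with exponent vector \<open>e\<close>. A coloring fixed by \<open>\<gamma>\<close> is a
  choice of one figure for each cycle of \<open>\<gamma>\<close>, and a figure on a \<open>k\<close>-cycle contributes \<open>k\<close> times
  its weight. So the substitution turns \<open>s(\<gamma>)\<close> into the series counting the colorings fixed
  by \<open>\<gamma>\<close>, and the coefficient of \<open>Z(G; f)\<close> is
  \<open>1/|\<Gamma>| \<Sum>\<^sub>\<gamma> |F(\<gamma>)| |X\<^sub>e\<^sup>\<gamma>|\<close>, where \<open>X\<^sub>e\<close> is the finite set of colorings of weight \<open>e\<close>. A version of
  Burnside's lemma for a pair of actions rewrites this as the sum over \<open>M \<in> R\<close> of the number of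
  orbits of the stabilizer of \<open>M\<close> on \<open>X\<^sub>e\<close>.
\<close>

section \<open>Group actions\<close>

text \<open>Each orbit meets \<open>R\<close> in exactly one point, so sending a point to its orbit
  is a bijection from \<open>R\<close> onto the set of orbits. The sum over \<open>E\<close> then
  splits along the disjoint orbits.\<close>

lemma (in group_action) sum_over_representatives:
  assumes fin: "finite E"
    and R: "R \<subseteq> E" "\<forall>I\<in>orbits G E \<phi>. \<exists>!x. x \<in> I \<and> x \<in> R"
  shows "(\<Sum>x\<in>E. h x) = (\<Sum>x\<in>R. \<Sum>y\<in>Group_Action.orbit G \<phi> x. h y)"
proof -
  have "inj_on (Group_Action.orbit G \<phi>) R"
  proof (rule inj_onI)
    fix x y assume xy: "x \<in> R" "y \<in> R"
      "Group_Action.orbit G \<phi> x = Group_Action.orbit G \<phi> y"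
    then have "x \<in> Group_Action.orbit G \<phi> x" "y \<in> Group_Action.orbit G \<phi> x"
      "Group_Action.orbit G \<phi> x \<in> orbits G E \<phi>"
      using R(1) orbit_refl by (auto simp: orbits_def)
    then show "x = y" using R(2) xy by blast
  qed
  moreover have "Group_Action.orbit G \<phi> ` R = orbits G E \<phi>"
  proof (intro equalityI subsetI)
    fix I assume I: "I \<in> orbits G E \<phi>"
    then obtain x where x: "x \<in> I" "x \<in> R" using R(2) by blast
    have "Group_Action.orbit G \<phi> x \<in> orbits G E \<phi>" "x \<in> Group_Action.orbit G \<phi> x"
      using x R(1) orbit_refl by (auto simp: orbits_def)
    then have "I = Group_Action.orbit G \<phi> x" using disjoint_union[OF I] x by blast
    then show "I \<in> Group_Action.orbit G \<phi> ` R" using x by blast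
  qed (use R(1) in \<open>auto simp: orbits_def\<close>)
  ultimately show ?thesis
    using disjoint_sum[OF fin, of h] sum.reindex[of "Group_Action.orbit G \<phi>" R "sum h"]
    by simp
qed

text \<open>The action of \<open>a\<close> carries the fixed points of \<open>g\<close> onto those
  of its conjugate, and the action of \<open>inv a\<close> carries them back.\<close>

lemma (in group_action) card_invariants_conj:
  assumes "a \<in> carrier G" "g \<in> carrier G"
  shows "card (invariants E \<phi> (a \<otimes> g \<otimes> inv a)) = card (invariants E \<phi> g)"
proof -
  interpret group G using group_hom by (rule group_hom.axioms(1))
  have 1: "\<phi> a x \<in> E" if "x \<in> E" "a \<in> carrier G" for x a
    using that element_image by blast
  have 2: "\<phi> (inv a) (\<phi> a x) = x" "\<phi> a (\<phi> (inv a) x) = x" if "x \<in> E" for x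
    using orbit_sym_aux[OF assms(1) that] orbit_sym_aux[of "inv a" x] that assms(1) by simp_all
  have "bij_betw (\<phi> a) (invariants E \<phi> g) (invariants E \<phi> (a \<otimes> g \<otimes> inv a))"
  proof (rule bij_betw_byWitness[where f' = "\<phi> (inv a)"])
    show "\<phi> a ` invariants E \<phi> g \<subseteq> invariants E \<phi> (a \<otimes> g \<otimes> inv a)"
    proof (intro image_subsetI)
      fix x assume "x \<in> invariants E \<phi> g"
      then have "x \<in> E" "\<phi> g x = x" by (auto simp: invariants_def)
      then show "\<phi> a x \<in> invariants E \<phi> (a \<otimes> g \<otimes> inv a)"
        using assms 1 2 by (simp add: invariants_def composition_rule)
    qed
    show "\<phi> (inv a) ` invariants E \<phi> (a \<otimes> g \<otimes> inv a) \<subseteq> invariants E \<phi> g"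
    proof (intro image_subsetI)
      fix x assume "x \<in> invariants E \<phi> (a \<otimes> g \<otimes> inv a)"
      then have x: "x \<in> E" "\<phi> a (\<phi> g (\<phi> (inv a) x)) = x"
        using assms 1 by (auto simp: invariants_def composition_rule)
      then have "\<phi> (inv a) x = \<phi> g (\<phi> (inv a) x)"
        using assms 1 2(1)[of "\<phi> g (\<phi> (inv a) x)"] by simp
      then show "\<phi> (inv a) x \<in> invariants E \<phi> g"
        using x(1) assms(1) 1 by (simp add: invariants_def)
    qed
  qed (use 2 in \<open>auto simp: invariants_def\<close>)
  then show ?thesis by (simp add: bij_betw_same_card)
qed

text \<open>Acting by \<open>inv a\<close> brings \<open>\<phi> a x\<close> back to
  \<open>x\<close>, which \<open>g\<close> fixes, and \<open>a\<close> returns it. Applied to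
  \<open>inv a\<close>, this also gives the reverse inclusion of the stabilizers.\<close>

lemma (in group_action) stabilizer_conj:
  assumes "a \<in> carrier G" "x \<in> E" "g \<in> stabilizer G \<phi> x"
  shows "a \<otimes> g \<otimes> inv a \<in> stabilizer G \<phi> (\<phi> a x)"
proof -
  interpret group G using group_hom by (rule group_hom.axioms(1))
  have "\<phi> a x \<in> E" "\<phi> (inv a) (\<phi> a x) = x"
    using orbit_sym_aux[OF assms(1,2)] element_image[OF assms(1,2)] by simp_all
  then show ?thesis using assms by (auto simp: stabilizer_def composition_rule)
qed

text \<open>
  Counting the triples of a group element with two fixed points by the first fixed point
  reduces the claim to Burnside's lemma for the stabilizers; the number of pairs belonging to a
  point of \<open>E\<close> is invariant under conjugation, hence constant on each orbit.
\<close>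

lemma burnside_stabilizers:
  assumes "group_action G E \<phi>" "group_action G X \<psi>"
    and fin: "finite (carrier G)" "finite E" "finite X"
    and R: "R \<subseteq> E" "\<forall>I\<in>orbits G E \<phi>. \<exists>!x. x \<in> I \<and> x \<in> R"
  shows "(\<Sum>g\<in>carrier G. card (invariants E \<phi> g) * card (invariants X \<psi> g)) =
    order G * (\<Sum>x\<in>R. card (orbits (G\<lparr>carrier := stabilizer G \<phi> x\<rparr>) X \<psi>))"
proof -
  interpret E: group_action G E \<phi> by fact
  interpret X: group_action G X \<psi> by fact
  interpret G: group G using E.group_hom by (rule group_hom.axioms(1))
  define h where "h x = (\<Sum>g\<in>stabilizer G \<phi> x. card (invariants X \<psi> g))" for x
  have conj: "h (\<phi> a x) = h x" if a: "a \<in> carrier G" and x: "x \<in> E" for a x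
  proof -
    have ax: "\<phi> a x \<in> E" "\<phi> (inv\<^bsub>G\<^esub> a) (\<phi> a x) = x"
      using E.orbit_sym_aux[OF a x] E.element_image[OF a x] by simp_all
    \<comment> \<open>With \<open>b = a\<close> this is one composite of the two conjugations; with
      \<open>b = inv a\<close> it is the other.\<close>
    have cancel: "b \<otimes>\<^bsub>G\<^esub> (inv\<^bsub>G\<^esub> b \<otimes>\<^bsub>G\<^esub> g \<otimes>\<^bsub>G\<^esub> b) \<otimes>\<^bsub>G\<^esub> inv\<^bsub>G\<^esub> b = g"
      if "b \<in> carrier G" "g \<in> carrier G" for b g
      using that by (simp add: G.m_assoc[symmetric]) (simp add: G.m_assoc)
    have stab: "stabilizer G \<phi> y \<subseteq> carrier G" for y by (auto simp: stabilizer_def)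
    show ?thesis unfolding h_def
    proof (rule sum.reindex_bij_witness
        [where i = "\<lambda>g. a \<otimes>\<^bsub>G\<^esub> g \<otimes>\<^bsub>G\<^esub> inv\<^bsub>G\<^esub> a" and j = "\<lambda>g. inv\<^bsub>G\<^esub> a \<otimes>\<^bsub>G\<^esub> g \<otimes>\<^bsub>G\<^esub> a"])
      fix g assume g: "g \<in> stabilizer G \<phi> (\<phi> a x)"
      show "inv\<^bsub>G\<^esub> a \<otimes>\<^bsub>G\<^esub> g \<otimes>\<^bsub>G\<^esub> a \<in> stabilizer G \<phi> x"
        using E.stabilizer_conj[of "inv\<^bsub>G\<^esub> a", OF _ ax(1) g] ax a by simp
      show "a \<otimes>\<^bsub>G\<^esub> (inv\<^bsub>G\<^esub> a \<otimes>\<^bsub>G\<^esub> g \<otimes>\<^bsub>G\<^esub> a) \<otimes>\<^bsub>G\<^esub> inv\<^bsub>G\<^esub> a = g"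
        using g stab a cancel by blast
      show "card (invariants X \<psi> (inv\<^bsub>G\<^esub> a \<otimes>\<^bsub>G\<^esub> g \<otimes>\<^bsub>G\<^esub> a)) = card (invariants X \<psi> g)"
        using X.card_invariants_conj[of "inv\<^bsub>G\<^esub> a" g] a g stab by auto
    next
      fix g assume g: "g \<in> stabilizer G \<phi> x"
      show "a \<otimes>\<^bsub>G\<^esub> g \<otimes>\<^bsub>G\<^esub> inv\<^bsub>G\<^esub> a \<in> stabilizer G \<phi> (\<phi> a x)"
        using E.stabilizer_conj[OF a x g] .
      show "inv\<^bsub>G\<^esub> a \<otimes>\<^bsub>G\<^esub> (a \<otimes>\<^bsub>G\<^esub> g \<otimes>\<^bsub>G\<^esub> inv\<^bsub>G\<^esub> a) \<otimes>\<^bsub>G\<^esub> a = g"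
        using cancel[of "inv\<^bsub>G\<^esub> a" g] g stab a by auto
    qed
  qed
  \<comment> \<open>Double counting: the number of fixed points becomes a sum of indicators over
    \<open>E\<close>. After the sums are swapped, the elements surviving for a given
    \<open>x\<close> are its stabilizer.\<close>
  have "(\<Sum>g\<in>carrier G. card (invariants E \<phi> g) * card (invariants X \<psi> g)) =
      (\<Sum>g\<in>carrier G. \<Sum>x\<in>E. if \<phi> g x = x then card (invariants X \<psi> g) else 0)"
    using fin by (simp add: invariants_def sum.inter_filter[symmetric])
  also have "\<dots> = (\<Sum>x\<in>E. h x)"
    unfolding h_def stabilizer_def
    using fin by (subst sum.swap) (simp add: sum.inter_filter)
  also have "\<dots> = (\<Sum>x\<in>R. \<Sum>y\<in>Group_Action.orbit G \<phi> x. h y)"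
    by (rule E.sum_over_representatives) (use fin R in auto)
  \<comment> \<open>Burnside for the stabilizer makes \<open>h x\<close> the number of its orbits on
    \<open>X\<close> times its order. The orbit of \<open>x\<close> contributes the remaining
    factor, by the orbit-stabilizer theorem.\<close>
  also have "\<dots> = (\<Sum>x\<in>R. order G * card (orbits (G\<lparr>carrier := stabilizer G \<phi> x\<rparr>) X \<psi>))"
  proof (rule sum.cong)
    fix x assume "x \<in> R"
    then have x: "x \<in> E" using R by blast
    let ?S = "stabilizer G \<phi> x" let ?H = "G\<lparr>carrier := ?S\<rparr>"
    have "group_action ?H X \<psi>"
      using X.induced_action[OF E.stabilizer_subgroup[OF x]] .
    then have "card (orbits ?H X \<psi>) * order ?H = (\<Sum>g\<in>carrier ?H. card (invariants X \<psi> g))"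
      by (rule group_action.burnside)
        (use fin finite_subset[OF E.stabilizer_subset] in auto)
    then have *: "card (orbits ?H X \<psi>) * card ?S = h x" by (simp add: h_def order_def)
    have "(\<Sum>y\<in>Group_Action.orbit G \<phi> x. h y) = card (Group_Action.orbit G \<phi> x) * h x"
    proof -
      have "h y = h x" if "y \<in> Group_Action.orbit G \<phi> x" for y
        using that conj[OF _ x] by (auto simp: Group_Action.orbit_def)
      then show ?thesis by simp
    qed
    also have "\<dots> = order G * card (orbits ?H X \<psi>)"
      unfolding *[symmetric] E.orbit_stabilizer_theorem[OF x, symmetric] by (simp add: mult_ac)
    finally show "(\<Sum>y\<in>Group_Action.orbit G \<phi> x. h y) = order G * card (orbits ?H X \<psi>)" .
  qed simp
  finally show ?thesis by (simp add: sum_distrib_left)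
qed

section \<open>Actions on the elements of one weight\<close>

text \<open>The set of all colorings may be infinite, whereas Burnside counts on a finite set; this
  allows passing to the colorings of one weight. The explicit \<open>restrict\<close> is there
  because the bijections in \<open>BijGroup X\<close> are extensional.\<close>

lemma (in group_action) restrict_action:
  assumes X: "X \<subseteq> E" and cl: "\<And>g x. g \<in> carrier G \<Longrightarrow> x \<in> X \<Longrightarrow> \<phi> g x \<in> X"
  shows "group_action G X (\<lambda>g. restrict (\<phi> g) X)"
proof (rule group_actionI)
  show "group G" using group_hom group_hom.axioms(1) by blast
  show "restrict (\<phi> \<one>) X x = x" if "x \<in> X" for x
    using that X id_eq_one by (metis restrict_apply' subsetD)
  fix g h x assume gh: "g \<in> carrier G" "h \<in> carrier G" and x: "x \<in> X"
  then show "restrict (\<phi> (g \<otimes> h)) X x = restrict (\<phi> g) X (restrict (\<phi> h) X x)"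
    using X cl[OF gh(2) x] composition_rule[of x g h] by auto
qed (use cl in auto)

text \<open>Since \<open>w\<close> is constant on orbits, an orbit lies inside a single weight
  class, and its weight can be read off at any chosen element. On points of \<open>X e\<close> the
  restricted and the original action have the same orbits.\<close>

lemma (in group_action) orbits_of_weight:
  assumes w: "\<And>g x. g \<in> carrier G \<Longrightarrow> x \<in> E \<Longrightarrow> w (\<phi> g x) = w x"
  defines "X \<equiv> \<lambda>e. {x \<in> E. w x = e}"
  shows "orbits G (X e) (\<lambda>g. restrict (\<phi> g) (X e)) = {C \<in> orbits G E \<phi>. w (SOME x. x \<in> C) = e}"
proof -
  have orb: "Group_Action.orbit G (\<lambda>g. restrict (\<phi> g) (X e)) x = Group_Action.orbit G \<phi> x"
    if "x \<in> X e" for x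
    using that by (auto simp: Group_Action.orbit_def)
  have "w (SOME y. y \<in> Group_Action.orbit G \<phi> x) = w x" if x: "x \<in> E" for x
    using someI[of "\<lambda>y. y \<in> Group_Action.orbit G \<phi> x", OF orbit_refl[OF x]] x w
    by (auto simp: Group_Action.orbit_def)
  then have "{C \<in> orbits G E \<phi>. w (SOME x. x \<in> C) = e} = Group_Action.orbit G \<phi> ` X e"
    by (auto simp: orbits_def X_def)
  also have "\<dots> = orbits G (X e) (\<lambda>g. restrict (\<phi> g) (X e))"
    by (auto simp: orbits_def orb[symmetric])
  finally show ?thesis ..
qed

section \<open>Figure counting series\<close>

lemma mfps_nth_0 [simp]: "mfps_nth 0 e = 0"
  by (simp add: zero_mfps_def)

lemma mfps_nth_add [simp]: "mfps_nth (F + H) e = mfps_nth F e + mfps_nth H e"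
  by (simp add: plus_mfps_def)

lemma mfps_nth_sum: "mfps_nth (\<Sum>i\<in>I. F i) e = (\<Sum>i\<in>I. mfps_nth (F i) e)"
  by (induction I rule: infinite_finite_induct) auto

lemma mfps_nth_const_mult:
  "mfps_nth (mfps_const a * F) e = (a :: 'a::comm_ring_1) * mfps_nth F (e :: nat ^ 'n::finite)"
proof -
  have "mfps_nth (mfps_const a * F) e =
      (\<Sum>p\<in>exp_splits e. if p = (0, e) then a * mfps_nth F e else 0)"
    unfolding times_mfps_def mfps_const_def mfps_nth_Abs
    by (rule sum.cong) (auto simp: exp_splits_def split: if_splits)
  also have "\<dots> = a * mfps_nth F e"
    by (subst sum.delta, simp) (simp add: exp_splits_def)
  finally show ?thesis .
qed

lemma mfps_monom_add:
  "(mfps_monom (p + q) :: ('a::comm_ring_1, 'n::finite) mfps) = mfps_monom p * mfps_monom q"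
proof -
  have "(mfps_monom p :: ('a, 'n) mfps) = Abs_mfps (\<lambda>e. if e = p then 1 else 0)" for p
    by (rule mfps_eqI) (simp add: mfps_nth_monom)
  then show ?thesis by (simp add: mfps_monom_mult)
qed

lemma mfps_monom_0 [simp]: "mfps_monom 0 = 1"
  by (simp add: mfps_monom_def)

lemma mfps_monom_sum: "finite A \<Longrightarrow> mfps_monom (\<Sum>i\<in>A. p i) = (\<Prod>i\<in>A. mfps_monom (p i))"
  by (induction A rule: finite_induct) (simp_all add: mfps_monom_add)

text \<open>Every monomial has coefficient 0 or 1, so the coefficient is a cardinality and
  identities of series become counting statements. If infinitely many figures have weight
  \<open>e\<close>, both sides are 0 by the conventions for \<open>sum\<close> and
  \<open>card\<close>.\<close>

lemma mfps_nth_figure_series: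
  fixes w :: "'y \<Rightarrow> nat ^ 'n::finite"
  shows "mfps_nth (figure_series Y w) e = of_nat (card {y \<in> Y. w y = e})"
proof -
  have "{y \<in> Y. mfps_nth (mfps_monom (w y) :: (rat, 'n) mfps) e \<noteq> 0} = {y \<in> Y. w y = e}"
    by (auto simp: mfps_nth_monom)
  then show ?thesis by (simp add: figure_series_def mfps_sum_def mfps_nth_monom)
qed

lemma figure_series_bij_betw:
  assumes "bij_betw h A B" and "\<And>a. a \<in> A \<Longrightarrow> v (h a) = u a"
  shows "figure_series A u = figure_series B v"
proof (rule mfps_eqI)
  fix e
  have "bij_betw h {a \<in> A. u a = e} {b \<in> B. v b = e}"
    using assms by (intro bij_betw_subset[OF assms(1)]) (auto simp: bij_betw_def)
  then show "mfps_nth (figure_series A u) e = mfps_nth (figure_series B v) e"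
    by (simp add: mfps_nth_figure_series bij_betw_same_card)
qed

section \<open>Products of figure counting series\<close>

text \<open>The pairs of total weight \<open>e\<close> fall into disjoint rectangles, one for each
  way of splitting \<open>e\<close> into two exponent vectors.\<close>

lemma figure_series_mult:
  fixes u :: "'b \<Rightarrow> nat ^ 'n::finite"
  assumes "\<And>e. finite {a \<in> A. u a = e}" "\<And>e. finite {b \<in> B. v b = e}"
  shows "figure_series A u * figure_series B v = figure_series (A \<times> B) (\<lambda>(a, b). u a + v b)"
proof (rule mfps_eqI)
  fix e :: "nat ^ 'n"
  define S where "S = (\<lambda>(p, q). {a \<in> A. u a = p} \<times> {b \<in> B. v b = q})"
  have "{x \<in> A \<times> B. (case x of (a, b) \<Rightarrow> u a + v b) = e} = (\<Union>x\<in>exp_splits e. S x)"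
    by (auto simp: S_def exp_splits_def)
  also have "card \<dots> = (\<Sum>x\<in>exp_splits e. card (S x))"
    by (rule card_UN_disjoint) (use assms in \<open>auto simp: S_def\<close>)
  finally show "mfps_nth (figure_series A u * figure_series B v) e =
      mfps_nth (figure_series (A \<times> B) (\<lambda>(a, b). u a + v b)) e"
    by (simp add: times_mfps_def mfps_nth_figure_series S_def card_cartesian_product case_prod_unfold)
qed

text \<open>Weights are nonnegative, so no single value can weigh more than the total
  \<open>e\<close>. This leaves finitely many candidates at each of the finitely many indices, even
  when \<open>Y\<close> is infinite.\<close>

lemma finite_weight_PiE:
  fixes w :: "'i \<Rightarrow> 'y \<Rightarrow> nat ^ 'n::finite"
  assumes I: "finite I" and w: "\<And>i e. i \<in> I \<Longrightarrow> finite {y \<in> Y. w i y = e}"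
  shows "finite {d \<in> I \<rightarrow>\<^sub>E Y. (\<Sum>i\<in>I. w i (d i)) = e}"
proof (rule finite_subset)
  \<comment> \<open>The first components of the splits of \<open>e\<close> are the exponent vectors
    dominated by \<open>e\<close>.\<close>
  let ?Y = "\<lambda>i. \<Union>p\<in>fst ` exp_splits e. {y \<in> Y. w i y = p}"
  show "finite (\<Pi>\<^sub>E i\<in>I. ?Y i)"
    using assms by (intro finite_PiE finite_UN_I) auto
  show "{d \<in> I \<rightarrow>\<^sub>E Y. (\<Sum>i\<in>I. w i (d i)) = e} \<subseteq> (\<Pi>\<^sub>E i\<in>I. ?Y i)"
  proof safe
    fix d i assume d: "d \<in> I \<rightarrow>\<^sub>E Y" "e = (\<Sum>i\<in>I. w i (d i))" and i: "i \<in> I"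
    have "e = w i (d i) + (\<Sum>j\<in>I - {i}. w j (d j))"
      using d I i by (simp add: sum.remove)
    then have "(w i (d i), \<Sum>j\<in>I - {i}. w j (d j)) \<in> exp_splits e"
      by (simp add: exp_splits_def)
    then have "w i (d i) \<in> fst ` exp_splits e"
      by (metis fst_conv image_eqI)
    then show "d i \<in> (\<Union>p\<in>fst ` exp_splits (\<Sum>i\<in>I. w i (d i)). {y \<in> Y. w i y = p})"
      using d i by auto
  qed auto
qed

text \<open>Multiplying the series amounts to choosing a figure at each index independently. The
  induction adds one index at a time, the update \<open>d(i := y)\<close> matching pairs with
  functions on the larger set.\<close>

lemma figure_series_prod:
  fixes w :: "'i \<Rightarrow> 'y \<Rightarrow> nat ^ 'n::finite"
  assumes "finite I" and "\<And>i e. i \<in> I \<Longrightarrow> finite {y \<in> Y. w i y = e}"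
  shows "(\<Prod>i\<in>I. figure_series Y (w i)) = figure_series (I \<rightarrow>\<^sub>E Y) (\<lambda>d. \<Sum>i\<in>I. w i (d i))"
  using assms
proof (induction I rule: finite_induct)
  \<comment> \<open>There is exactly one extensional function on the empty set, of weight 0, and its
    series is 1.\<close>
  case empty
  show ?case by (rule mfps_eqI) (auto simp: mfps_nth_figure_series one_mfps_def card_1_singleton_iff)
next
  case (insert i I)
  let ?h = "\<lambda>(y, d). d(i := y)"
  have bij: "bij_betw ?h (Y \<times> (I \<rightarrow>\<^sub>E Y)) (insert i I \<rightarrow>\<^sub>E Y)"
    using insert.hyps unfolding bij_betw_def
    using inj_combinator[of i I "\<lambda>_. Y"] by (simp add: PiE_insert_eq)
  have "(\<Prod>i\<in>insert i I. figure_series Y (w i)) =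
      figure_series Y (w i) * figure_series (I \<rightarrow>\<^sub>E Y) (\<lambda>d. \<Sum>i\<in>I. w i (d i))"
    using insert by simp
  also have "\<dots> = figure_series (Y \<times> (I \<rightarrow>\<^sub>E Y)) (\<lambda>(y, d). w i y + (\<Sum>i\<in>I. w i (d i)))"
    by (rule figure_series_mult) (use insert finite_weight_PiE[of I Y w] in auto)
  also have "\<dots> = figure_series (insert i I \<rightarrow>\<^sub>E Y) (\<lambda>d. \<Sum>i\<in>insert i I. w i (d i))"
    by (rule figure_series_bij_betw[OF bij]) (use insert.hyps in \<open>auto intro!: sum.cong\<close>)
  finally show ?case .
qed

section \<open>Substitution of powers of the variables\<close>

text \<open>Scaling by a positive \<open>k\<close> is injective, so the sum defining
  \<open>mfps_subst_power\<close> is a genuine finite sum. For \<open>k = 0\<close> and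
  \<open>e = 0\<close> the set would be infinite and the sum 0 by default.\<close>

lemma finite_scalar_mult_vimage:
  assumes "k \<ge> 1"
  shows "finite {d. k *s d = (e :: nat ^ 'n::finite)}"
proof -
  have "inj (\<lambda>d :: nat ^ 'n. k *s d)"
    using assms by (auto simp: inj_on_def vec_eq_iff)
  then show ?thesis
    using finite_vimageI[of "{e}" "\<lambda>d. k *s d"] by (simp add: vimage_def)
qed

text \<open>Raising every variable to its \<open>k\<close>-th power multiplies each exponent vector
  by \<open>k\<close>; the result counts the same figures with weights scaled by
  \<open>k\<close>.\<close>

lemma mfps_subst_power_figure_series:
  fixes w :: "'y \<Rightarrow> nat ^ 'n::finite"
  assumes "k \<ge> 1" and "\<And>e. finite {y \<in> Y. w y = e}"
  shows "mfps_subst_power k (figure_series Y w) = figure_series Y (\<lambda>y. k *s w y)"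
proof (rule mfps_eqI)
  fix e :: "nat ^ 'n"
  have "finite {d. k *s d = e}"
    using assms(1) by (rule finite_scalar_mult_vimage)
  then have "card (\<Union>d\<in>{d. k *s d = e}. {y \<in> Y. w y = d}) =
      (\<Sum>d | k *s d = e. card {y \<in> Y. w y = d})"
    by (intro card_UN_disjoint) (use assms in auto)
  moreover have "(\<Union>d\<in>{d. k *s d = e}. {y \<in> Y. w y = d}) = {y \<in> Y. k *s w y = e}"
    by auto
  ultimately show "mfps_nth (mfps_subst_power k (figure_series Y w)) e =
      mfps_nth (figure_series Y (\<lambda>y. k *s w y)) e"
    by (simp add: mfps_subst_power_def mfps_nth_figure_series)
qed

section \<open>Substitution into polynomials\<close>

text \<open>Monomials outside the support have coefficient 0. This puts two polynomials over a
  common index set, as additivity requires.\<close>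

lemma cpoly_subst_superset:
  assumes "finite K" "Poly_Mapping.keys P \<subseteq> K"
  shows "cpoly_subst \<sigma> P = (\<Sum>m\<in>K. mfps_const (Poly_Mapping.lookup P m) *
    (\<Prod>k\<in>Poly_Mapping.keys m. \<sigma> k ^ Poly_Mapping.lookup m k))"
  unfolding cpoly_subst_def
proof (rule sum.mono_neutral_left)
  show "\<forall>m\<in>K - Poly_Mapping.keys P. mfps_const (Poly_Mapping.lookup P m) *
    (\<Prod>k\<in>Poly_Mapping.keys m. \<sigma> k ^ Poly_Mapping.lookup m k) = 0"
    by (auto intro!: mfps_eqI simp: mfps_nth_const_mult in_keys_iff)
qed (use assms in auto)

lemma cpoly_subst_add:
  fixes \<sigma> :: "nat \<Rightarrow> ('a::comm_ring_1, 'n::finite) mfps"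
  shows "cpoly_subst \<sigma> (P + Q) = cpoly_subst \<sigma> P + cpoly_subst \<sigma> Q"
proof -
  let ?K = "Poly_Mapping.keys P \<union> Poly_Mapping.keys Q"
  have "(mfps_const (a + b) :: ('a, 'n) mfps) = mfps_const a + mfps_const b" for a b
    by (rule mfps_eqI) (simp add: mfps_const_def)
  then show ?thesis
    using Poly_Mapping.keys_add[of P Q]
    by (simp add: cpoly_subst_superset[of ?K] lookup_add sum.distrib algebra_simps)
qed

lemma cpoly_subst_sum: "cpoly_subst \<sigma> (\<Sum>i\<in>I. P i) = (\<Sum>i\<in>I. cpoly_subst \<sigma> (P i))"
proof (induction I rule: infinite_finite_induct)
  case empty
  then show ?case by (simp add: cpoly_subst_def)
next
  case (infinite A)
  then show ?case by (simp add: cpoly_subst_def)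
qed (simp add: cpoly_subst_add)

lemma cpoly_subst_single:
  assumes "finite K" "Poly_Mapping.keys m \<subseteq> K"
  shows "cpoly_subst \<sigma> (Poly_Mapping.single m a) =
    mfps_const a * (\<Prod>k\<in>K. \<sigma> k ^ Poly_Mapping.lookup m k)"
proof -
  have "cpoly_subst \<sigma> (Poly_Mapping.single m a) =
      mfps_const a * (\<Prod>k\<in>Poly_Mapping.keys m. \<sigma> k ^ Poly_Mapping.lookup m k)"
    by (subst cpoly_subst_superset[of "{m}"]) auto
  also have "(\<Prod>k\<in>Poly_Mapping.keys m. \<sigma> k ^ Poly_Mapping.lookup m k) =
      (\<Prod>k\<in>K. \<sigma> k ^ Poly_Mapping.lookup m k)"
    by (rule prod.mono_neutral_left) (use assms in \<open>auto simp: in_keys_iff\<close>)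
  finally show ?thesis .
qed

text \<open>Substitution is evaluated monomial by monomial, so the product of powers is first
  collapsed into a single monomial whose exponents are the cycle counts.\<close>

lemma cycle_monom_eq:
  "cycle_monom V \<gamma> =
    Poly_Mapping.single (\<Sum>k = 1..card V. Poly_Mapping.single k (num_cycles V \<gamma> k)) 1"
proof -
  have pow: "cpoly_var k ^ n = (Poly_Mapping.single (Poly_Mapping.single k n) 1 :: rat cpoly)"
    for k n
    by (induction n) (simp_all add: cpoly_var_def mult_single single_add[symmetric])
  have "(\<Prod>k\<in>K. cpoly_var k ^ f k) =
      (Poly_Mapping.single (\<Sum>k\<in>K. Poly_Mapping.single k (f k)) 1 :: rat cpoly)"
    if "finite K" for K f
    using that by induction (simp_all add: pow mult_single)
  then show ?thesis by (simp add: cycle_monom_def)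
qed

lemma cpoly_subst_const_mult_cycle_monom:
  "cpoly_subst \<sigma> (cpoly_const a * cycle_monom V \<gamma>) =
    mfps_const a * (\<Prod>k = 1..card V. \<sigma> k ^ num_cycles V \<gamma> k)"
proof -
  let ?m = "\<Sum>k = 1..card V. Poly_Mapping.single k (num_cycles V \<gamma> k)"
  have lookup: "Poly_Mapping.lookup ?m k = (if k \<in> {1..card V} then num_cycles V \<gamma> k else 0)" for k
    by (simp add: lookup_sum lookup_single when_def)
  then have "Poly_Mapping.keys ?m \<subseteq> {1..card V}"
    by (auto simp: in_keys_iff split: if_splits)
  then have "cpoly_subst \<sigma> (Poly_Mapping.single ?m a) =
      mfps_const a * (\<Prod>k = 1..card V. \<sigma> k ^ Poly_Mapping.lookup ?m k)"
    by (intro cpoly_subst_single) auto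
  also have "(\<Prod>k = 1..card V. \<sigma> k ^ Poly_Mapping.lookup ?m k) =
      (\<Prod>k = 1..card V. \<sigma> k ^ num_cycles V \<gamma> k)"
    by (intro prod.cong refl) (simp only: lookup if_True)
  finally show ?thesis
    by (simp add: cpoly_const_def cycle_monom_eq mult_single)
qed

lemma cpoly_subst_imbedding_sum:
  "cpoly_subst \<sigma> (imbedding_sum G) =
    (\<Sum>\<gamma>\<in>carrier (aut_group G).
      mfps_const (of_nat (card (fixed_maps G \<gamma>)) / of_nat (order (aut_group G))) *
      (\<Prod>k = 1..card (pverts G). \<sigma> k ^ num_cycles (pverts G) \<gamma> k))"
proof -
  \<comment> \<open>The factor \<open>1/|\<Gamma>|\<close> and the number of fixed maps merge into
    one constant, so that each summand is a constant times a cycle monomial.\<close>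
  have "cpoly_const a * (of_nat n * P) = cpoly_const (of_nat n * a) * P"
    for a :: rat and n and P :: "rat cpoly"
    by (simp add: cpoly_const_def mult_single mult.assoc[symmetric] flip: single_of_nat)
       (simp add: mult.commute)
  then have "imbedding_sum G = (\<Sum>\<gamma>\<in>carrier (aut_group G).
      cpoly_const (of_nat (card (fixed_maps G \<gamma>)) * (1 / of_nat (order (aut_group G)))) *
      cycle_monom (pverts G) \<gamma>)"
    by (simp only: imbedding_sum_def sum_distrib_left)
  then show ?thesis
    by (simp add: cpoly_subst_sum cpoly_subst_const_mult_cycle_monom)
qed

section \<open>Colorings fixed by an automorphism\<close>

lemma orbit_eq_iff:
  assumes "permutation \<gamma>"
  shows "Orbits.orbit \<gamma> x = Orbits.orbit \<gamma> y \<longleftrightarrow> x \<in> Orbits.orbit \<gamma> y"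
  using assms permutation_self_in_orbit orbit_trans orbit_swap by (metis subsetI subset_antisym)

text \<open>A function unchanged by \<open>\<gamma>\<close> is constant along each cycle, so it
  amounts to one value per cycle, a cycle being represented by its set of points.\<close>

lemma bij_betw_fixed_functions:
  assumes \<gamma>: "\<gamma> permutes V" and V: "finite V"
  shows "bij_betw (\<lambda>d. \<lambda>v\<in>V. d (Orbits.orbit \<gamma> v)) (Orbits.orbit \<gamma> ` V \<rightarrow>\<^sub>E Y)
    {c \<in> V \<rightarrow>\<^sub>E Y. \<forall>v\<in>V. c (\<gamma> v) = c v}"
proof -
  have perm: "permutation \<gamma>" using \<gamma> V by (rule permutes_imp_permutation[rotated])
  have step: "Orbits.orbit \<gamma> (\<gamma> v) = Orbits.orbit \<gamma> v" for v
    using perm by (simp add: permutation_orbit_step)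
  have mem: "\<gamma> v \<in> V \<longleftrightarrow> v \<in> V" for v using \<gamma> by (rule permutes_in_image)
  show ?thesis
  proof (rule bij_betwI')
    fix d d' assume d: "d \<in> Orbits.orbit \<gamma> ` V \<rightarrow>\<^sub>E Y" "d' \<in> Orbits.orbit \<gamma> ` V \<rightarrow>\<^sub>E Y"
    show "(\<lambda>v\<in>V. d (Orbits.orbit \<gamma> v)) = (\<lambda>v\<in>V. d' (Orbits.orbit \<gamma> v)) \<longleftrightarrow> d = d'"
    proof
      assume eq: "(\<lambda>v\<in>V. d (Orbits.orbit \<gamma> v)) = (\<lambda>v\<in>V. d' (Orbits.orbit \<gamma> v))"
      show "d = d'"
      proof (rule PiE_ext[OF d])
        fix C assume "C \<in> Orbits.orbit \<gamma> ` V"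
        then obtain v where "v \<in> V" "C = Orbits.orbit \<gamma> v" by blast
        then show "d C = d' C" using fun_cong[OF eq, of v] by simp
      qed
    qed simp
  next
    fix d assume "d \<in> Orbits.orbit \<gamma> ` V \<rightarrow>\<^sub>E Y"
    then show "(\<lambda>v\<in>V. d (Orbits.orbit \<gamma> v)) \<in> {c \<in> V \<rightarrow>\<^sub>E Y. \<forall>v\<in>V. c (\<gamma> v) = c v}"
      by (auto simp: step mem)
  next
    fix c assume "c \<in> {c \<in> V \<rightarrow>\<^sub>E Y. \<forall>v\<in>V. c (\<gamma> v) = c v}"
    then have c: "c \<in> V \<rightarrow>\<^sub>E Y" "\<And>v. v \<in> V \<Longrightarrow> c (\<gamma> v) = c v" by auto
    \<comment> \<open>The image of a cycle under \<open>c\<close> is a singleton, as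
      \<open>const\<close> shows below, so \<open>the_elem\<close> picks the common value.\<close>
    define d where "d = (\<lambda>C\<in>Orbits.orbit \<gamma> ` V. the_elem (c ` C))"
    have const: "c u = c v" if "u \<in> Orbits.orbit \<gamma> v" "v \<in> V" for u v
    proof -
      \<comment> \<open>Membership in \<open>V\<close> is carried through the induction along the
        cycle because \<open>c\<close> is known to be preserved by \<open>\<gamma>\<close> only at
        points of \<open>V\<close>.\<close>
      have "u \<in> V \<and> c u = c v"
        using that by induction (use c mem in auto)
      then show ?thesis by simp
    qed
    have d: "d (Orbits.orbit \<gamma> v) = c v" if v: "v \<in> V" for v
    proof -
      have "c ` Orbits.orbit \<gamma> v = {c v}"
      proof
        show "c ` Orbits.orbit \<gamma> v \<subseteq> {c v}" using const[OF _ v] by blast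
        show "{c v} \<subseteq> c ` Orbits.orbit \<gamma> v" using permutation_self_in_orbit[OF perm] by blast
      qed
      then show ?thesis using v by (simp add: d_def)
    qed
    have "d \<in> Orbits.orbit \<gamma> ` V \<rightarrow>\<^sub>E Y"
    proof (rule PiE_I)
      fix C assume "C \<in> Orbits.orbit \<gamma> ` V"
      then obtain v where "v \<in> V" "C = Orbits.orbit \<gamma> v" by blast
      then show "d C \<in> Y" using d[of v] c(1) by auto
    qed (simp add: d_def)
    moreover have "c = (\<lambda>v\<in>V. d (Orbits.orbit \<gamma> v))"
    proof
      fix v
      show "c v = (\<lambda>v\<in>V. d (Orbits.orbit \<gamma> v)) v"
        using c(1) d[of v] by (cases "v \<in> V") (auto simp: PiE_def extensional_def)
    qed
    ultimately show "\<exists>d\<in>Orbits.orbit \<gamma> ` V \<rightarrow>\<^sub>E Y. c = (\<lambda>v\<in>V. d (Orbits.orbit \<gamma> v))"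
      by blast
  qed
qed

text \<open>The power counting the \<open>k\<close>-cycles is a product with one factor per
  \<open>k\<close>-cycle, so the left side is a product over all cycles. Multiplying it out chooses
  a figure for each cycle, that is, a coloring fixed by \<open>\<gamma>\<close>.\<close>

lemma figure_series_fixed_functions:
  fixes wt :: "'y \<Rightarrow> nat ^ 'n::finite"
  assumes \<gamma>: "\<gamma> permutes V" and V: "finite V" and Y: "\<And>e. finite {y \<in> Y. wt y = e}"
  shows "(\<Prod>k = 1..card V. mfps_subst_power k (figure_series Y wt) ^ num_cycles V \<gamma> k) =
    figure_series {c \<in> V \<rightarrow>\<^sub>E Y. \<forall>v\<in>V. c (\<gamma> v) = c v} (\<lambda>c. \<Sum>v\<in>V. wt (c v))"
proof -
  let ?O = "Orbits.orbit \<gamma> ` V"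
  have perm: "permutation \<gamma>" using \<gamma> V by (rule permutes_imp_permutation[rotated])
  have sub: "C \<subseteq> V" if "C \<in> ?O" for C
    using that permutes_orbit_subset[OF \<gamma>] by auto
  have fibre: "{v \<in> V. Orbits.orbit \<gamma> v = C} = C" if "C \<in> ?O" for C
    using that sub[OF that] orbit_eq_iff[OF perm] by blast
  \<comment> \<open>Cycle lengths lie between 1 and \<open>card V\<close>: grouping by length misses
    no cycle, and every substituted power is positive.\<close>
  have card: "card C \<in> {1..card V}" if "C \<in> ?O" for C
  proof -
    have "C \<noteq> {}" using that permutation_self_in_orbit[OF perm] by auto
    then show ?thesis
      using sub[OF that] V by (simp add: Suc_le_eq card_gt_0_iff finite_subset card_mono)
  qed
  have "(\<Prod>k = 1..card V. mfps_subst_power k (figure_series Y wt) ^ num_cycles V \<gamma> k) =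
      (\<Prod>k = 1..card V. \<Prod>C | C \<in> ?O \<and> card C = k. mfps_subst_power (card C) (figure_series Y wt))"
    by (simp add: num_cycles_def)
  also have "\<dots> = (\<Prod>C\<in>?O. mfps_subst_power (card C) (figure_series Y wt))"
    by (rule prod.group) (use V card in auto)
  also have "\<dots> = (\<Prod>C\<in>?O. figure_series Y (\<lambda>y. card C *s wt y))"
    using card by (intro prod.cong refl mfps_subst_power_figure_series Y) auto
  also have "\<dots> = figure_series (?O \<rightarrow>\<^sub>E Y) (\<lambda>d. \<Sum>C\<in>?O. card C *s wt (d C))"
  proof (rule figure_series_prod)
    fix C and e :: "nat ^ 'n" assume "C \<in> ?O"
    then have "finite {p. card C *s p = e}"
      using card[of C] by (intro finite_scalar_mult_vimage) auto
    then have "finite (\<Union>p\<in>{p. card C *s p = e}. {y \<in> Y. wt y = p})" using Y by blast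
    then show "finite {y \<in> Y. card C *s wt y = e}"
      by (rule rev_finite_subset) auto
  qed (use V in simp)
  also have "\<dots> =
      figure_series {c \<in> V \<rightarrow>\<^sub>E Y. \<forall>v\<in>V. c (\<gamma> v) = c v} (\<lambda>c. \<Sum>v\<in>V. wt (c v))"
  \<comment> \<open>The bijection preserves weight: summed cycle by cycle, the weight of a fixed
    coloring takes \<open>wt (d C)\<close> once for every point of \<open>C\<close>.\<close>
  proof (rule figure_series_bij_betw[OF bij_betw_fixed_functions[OF \<gamma> V]])
    fix d
    have "(\<Sum>v\<in>V. wt ((\<lambda>v\<in>V. d (Orbits.orbit \<gamma> v)) v)) = (\<Sum>v\<in>V. wt (d (Orbits.orbit \<gamma> v)))"
      by simp
    also have "\<dots> = (\<Sum>C\<in>?O. \<Sum>v | v \<in> V \<and> Orbits.orbit \<gamma> v = C. wt (d (Orbits.orbit \<gamma> v)))"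
      by (rule sum.group[symmetric]) (use V in auto)
    also have "\<dots> = (\<Sum>C\<in>?O. card C *s wt (d C))"
    proof (rule sum.cong[OF refl])
      fix C assume C: "C \<in> ?O"
      have "(\<Sum>v | v \<in> V \<and> Orbits.orbit \<gamma> v = C. wt (d (Orbits.orbit \<gamma> v))) = (\<Sum>v\<in>C. wt (d C))"
        by (rule sum.cong) (use fibre[OF C] in auto)
      also have "\<dots> = card C *s wt (d C)" by (simp add: vec_eq_iff of_nat_index)
      finally show "(\<Sum>v | v \<in> V \<and> Orbits.orbit \<gamma> v = C. wt (d (Orbits.orbit \<gamma> v))) =
        card C *s wt (d C)" .
    qed
    finally show "(\<Sum>v\<in>V. wt ((\<lambda>v\<in>V. d (Orbits.orbit \<gamma> v)) v)) = (\<Sum>C\<in>?O. card C *s wt (d C))" .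
  qed
  finally show ?thesis .
qed

text \<open>The action involves the inverse of \<open>\<gamma>\<close>; replacing \<open>v\<close>
  by \<open>\<gamma> v\<close> turns invariance into the condition without inverses.\<close>

lemma invariants_colorings:
  assumes \<gamma>: "\<gamma> permutes pverts G"
  shows "invariants (colorings G Y) (color_action G Y) \<gamma> =
    {c \<in> pverts G \<rightarrow>\<^sub>E Y. \<forall>v\<in>pverts G. c (\<gamma> v) = c v}"
proof -
  have mem: "\<gamma> v \<in> pverts G \<longleftrightarrow> v \<in> pverts G"
    "Hilbert_Choice.inv \<gamma> v \<in> pverts G \<longleftrightarrow> v \<in> pverts G" for v
    using permutes_in_image[OF \<gamma>] permutes_in_image[OF permutes_inv[OF \<gamma>]] by auto
  have "(\<lambda>v\<in>pverts G. c (Hilbert_Choice.inv \<gamma> v)) = c \<longleftrightarrow> (\<forall>v\<in>pverts G. c (\<gamma> v) = c v)"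
    if c: "c \<in> pverts G \<rightarrow>\<^sub>E Y" for c
  proof
    assume eq: "(\<lambda>v\<in>pverts G. c (Hilbert_Choice.inv \<gamma> v)) = c"
    show "\<forall>v\<in>pverts G. c (\<gamma> v) = c v"
    proof
      fix v assume "v \<in> pverts G"
      then show "c (\<gamma> v) = c v"
        using fun_cong[OF eq, of "\<gamma> v"] mem \<gamma> by (simp add: permutes_inverses)
    qed
  next
    assume fixed: "\<forall>v\<in>pverts G. c (\<gamma> v) = c v"
    show "(\<lambda>v\<in>pverts G. c (Hilbert_Choice.inv \<gamma> v)) = c"
    proof
      fix v
      show "(\<lambda>v\<in>pverts G. c (Hilbert_Choice.inv \<gamma> v)) v = c v"
        using fixed[rule_format, of "Hilbert_Choice.inv \<gamma> v"] mem(2)[of v] \<gamma> c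
        by (auto simp: permutes_inverses PiE_def extensional_def)
    qed
  qed
  then show ?thesis by (auto simp: invariants_def color_action_def colorings_def)
qed

section \<open>Configurations\<close>

lemma finite_aut_group:
  assumes "finite (pverts G)"
  shows "finite (carrier (aut_group G))"
  by (rule finite_subset[OF _ finite_permutations[OF assms]]) (auto simp: aut_group_def)

lemma finite_graph_maps:
  assumes "pair_graph G"
  shows "finite (graph_maps G)"
proof -
  interpret pair_graph G by fact
  have "finite {r. rotation G v r}" for v
  proof -
    have "nbrs G v \<subseteq> pverts G" by (auto simp: nbrs_def dest: in_arcsD2)
    then have "finite (nbrs G v)" using pair_finite_verts finite_subset by blast
    then show ?thesis
      by (rule finite_subset[rotated, OF finite_permutations]) (auto simp: rotation_def)
  qed
  then show ?thesis unfolding graph_maps_def by (intro finite_PiE pair_finite_verts)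
qed

text \<open>An automorphism only reindexes the sum over the vertices. This is why weights are
  constant on configurations.\<close>

lemma sum_color_action:
  assumes "\<gamma> \<in> carrier (aut_group G)" "c \<in> colorings G Y"
  shows "(\<Sum>v\<in>pverts G. (wt (color_action G Y \<gamma> c v) :: 'a::comm_monoid_add)) =
    (\<Sum>v\<in>pverts G. wt (c v))"
proof -
  have "Hilbert_Choice.inv \<gamma> permutes pverts G"
    using assms(1) by (intro permutes_inv permutes_pverts)
  from sum.permute[OF this, of "\<lambda>v. wt (c v)"] show ?thesis
    using assms(2) by (simp add: color_action_def)
qed

theorem theorem7:
  fixes G :: "'v pair_pre_digraph"
    and R :: "('v \<Rightarrow> 'v \<Rightarrow> 'v) set"
    and Y :: "'y set"
    and wt :: "'y \<Rightarrow> nat ^ 'n"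
  assumes "pair_graph G"
    and "Digraph_Component.connected (with_proj G)"
    and "complete_representatives G R"
    and "\<And>p. finite {y \<in> Y. wt y = p}"
  shows "(\<forall>M\<in>R.
            group_action (map_aut_group G M) (colorings G Y) (color_action G Y) \<and>
            (\<forall>C\<in>configurations G Y M. \<forall>c\<in>C. \<forall>d\<in>C. color_weight G wt c = color_weight G wt d) \<and>
            mfps_summable (config_weight G wt) (configurations G Y M)) \<and>
         cpoly_subst (\<lambda>k. mfps_subst_power k (figure_series Y wt)) (imbedding_sum G) =
           (\<Sum>M\<in>R. mfps_sum (config_weight G wt) (configurations G Y M))"
proof -
  interpret pair_graph G by fact
  interpret maps: group_action "aut_group G" "graph_maps G" "map_action G"
    using assms(1) by (rule group_action_maps)
  interpret cols: group_action "aut_group G" "colorings G Y" "color_action G Y"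
    by (rule group_action_colorings)
  interpret aut: group "aut_group G" by (rule group_aut_group)
  have R: "R \<subseteq> graph_maps G"
    "\<forall>I\<in>orbits (aut_group G) (graph_maps G) (map_action G). \<exists>!M. M \<in> I \<and> M \<in> R"
    using assms(3) by (simp_all add: complete_representatives_def unlabeled_imbeddings_def)
  have fin: "finite (pverts G)" "finite (carrier (aut_group G))" "finite (graph_maps G)"
    using pair_finite_verts finite_aut_group[OF pair_finite_verts] finite_graph_maps[OF assms(1)]
    by blast+
  have "order (aut_group G) \<noteq> 0"
    using aut.order_gt_0_iff_finite fin(2) by simp

  \<comment> \<open>\<open>W c\<close> is the exponent vector of the weight of \<open>c\<close>, and
    \<open>X e\<close> is the finite layer of colorings with exponent vector \<open>e\<close>.
    \<open>S C\<close> reads the exponent vector of a configuration at an arbitrary member.\<close>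
  define W where "W c = (\<Sum>v\<in>pverts G. wt (c v))" for c
  define X where "X e = {c \<in> colorings G Y. W c = e}" for e
  define act where "act e g = restrict (color_action G Y g) (X e)" for e g
  define S where "S C = W (SOME c. c \<in> C)" for C
  have W: "W (color_action G Y g c) = W c"
    if "g \<in> carrier (aut_group G)" "c \<in> colorings G Y" for g c
    using sum_color_action[OF that, of wt] by (simp add: W_def)
  have cw: "color_weight G wt c = mfps_monom (W c)" for c
    using fin(1) by (simp add: color_weight_def W_def mfps_monom_sum)
  have finX: "finite (X e)" for e
    using finite_weight_PiE[of "pverts G" Y "\<lambda>_. wt"] fin(1) assms(4)
    by (simp add: X_def W_def colorings_def)
  have actX: "group_action (aut_group G) (X e) (act e)" for e
    unfolding act_def
  proof (rule cols.restrict_action)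
    fix g c assume "g \<in> carrier (aut_group G)" "c \<in> X e"
    then show "color_action G Y g c \<in> X e"
      using cols.element_image[of g c] W[of g c] by (simp add: X_def)
  qed (auto simp: X_def)
  have inv: "invariants (X e) (act e) g =
      {c \<in> {c \<in> pverts G \<rightarrow>\<^sub>E Y. \<forall>v\<in>pverts G. c (g v) = c v}. W c = e}"
    if "g \<in> carrier (aut_group G)" for e g
    using invariants_colorings[OF permutes_pverts[OF that], of Y]
    by (auto simp: invariants_def X_def act_def)

  have actM: "group_action (map_aut_group G M) (colorings G Y) (color_action G Y)"
    if "M \<in> R" for M
    unfolding map_aut_group_def
    by (rule cols.induced_action[OF maps.stabilizer_subgroup]) (use R that in blast)
  have sub: "carrier (map_aut_group G M) \<subseteq> carrier (aut_group G)" for M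
    using maps.stabilizer_subset by (simp add: map_aut_group_def)
  \<comment> \<open>The stabilizer of \<open>M\<close> consists of automorphisms, which preserve
    \<open>W\<close>, so the choice made in \<open>S\<close> does not matter.\<close>
  have WC: "W c = S C" if "M \<in> R" and C: "C \<in> configurations G Y M" and c: "c \<in> C" for M C c
  proof -
    obtain x where x: "x \<in> colorings G Y"
      "C = Group_Action.orbit (map_aut_group G M) (color_action G Y) x"
      using C by (auto simp: configurations_def orbits_def)
    have "W b = W x" if "b \<in> C" for b
      using that x sub W by (auto simp: Group_Action.orbit_def)
    then show ?thesis using c someI[of "\<lambda>c. c \<in> C"] unfolding S_def by metis
  qed
  \<comment> \<open>Nonemptiness makes the set of weights on \<open>C\<close> an actual singleton,
    as \<open>the_elem\<close> in \<open>config_weight\<close> requires.\<close>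
  have ne: "C \<noteq> {}" if "M \<in> R" "C \<in> configurations G Y M" for M C
    using that group_action.orbit_refl[OF actM]
    by (fastforce simp: configurations_def orbits_def)
  have conf: "config_weight G wt C = mfps_monom (S C)"
    if "M \<in> R" "C \<in> configurations G Y M" for M C
  proof -
    have "color_weight G wt ` C = {mfps_monom (S C)}"
      using WC[OF that] ne[OF that] by (auto simp: cw)
    then show ?thesis by (simp add: config_weight_def)
  qed
  \<comment> \<open>This links the two sides: the orbits counted by Burnside on one layer are
    precisely the configurations contributing to the coefficient of \<open>e\<close>.\<close>
  have orbs: "orbits (map_aut_group G M) (X e) (act e) = {C \<in> configurations G Y M. S C = e}"
    if "M \<in> R" for M e
    unfolding X_def act_def configurations_def S_def
    by (rule group_action.orbits_of_weight[OF actM[OF that]]) (use sub W in blast)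
  have finC: "finite {C \<in> configurations G Y M. S C = e}" if "M \<in> R" for M e
    unfolding orbs[OF that, symmetric] orbits_def using finX by simp
  have nthC: "mfps_nth (config_weight G wt C) e = (if S C = e then 1 else 0)"
    if "M \<in> R" "C \<in> configurations G Y M" for M C e
    using conf[OF that] by (simp add: mfps_nth_monom)
  have supp: "{C \<in> configurations G Y M. mfps_nth (config_weight G wt C) e \<noteq> 0} =
      {C \<in> configurations G Y M. S C = e}" if "M \<in> R" for M e
    using nthC[OF that] by (auto split: if_splits)
  have sumC: "mfps_nth (mfps_sum (config_weight G wt) (configurations G Y M)) e =
      of_nat (card (orbits (map_aut_group G M) (X e) (act e)))" if "M \<in> R" for M e
    using nthC[OF that] by (simp add: mfps_sum_def supp[OF that] orbs[OF that])

  have "cpoly_subst (\<lambda>k. mfps_subst_power k (figure_series Y wt)) (imbedding_sum G) =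
      (\<Sum>M\<in>R. mfps_sum (config_weight G wt) (configurations G Y M))"
  proof (rule mfps_eqI)
    fix e
    let ?n = "of_nat (order (aut_group G)) :: rat"
    have "mfps_nth (cpoly_subst (\<lambda>k. mfps_subst_power k (figure_series Y wt)) (imbedding_sum G)) e =
        (\<Sum>g\<in>carrier (aut_group G). of_nat (card (fixed_maps G g)) / ?n *
          of_nat (card (invariants (X e) (act e) g)))"
      unfolding cpoly_subst_imbedding_sum mfps_nth_sum mfps_nth_const_mult
      by (intro sum.cong refl arg_cong2[where f = "(*)"])
         (simp add: figure_series_fixed_functions permutes_pverts fin(1) assms(4)
           mfps_nth_figure_series inv W_def del: One_nat_def)
    also have "\<dots> = of_nat (\<Sum>g\<in>carrier (aut_group G).
        card (invariants (graph_maps G) (map_action G) g) *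
        card (invariants (X e) (act e) g)) / ?n"
      by (simp add: fixed_maps_def sum_divide_distrib)
    \<comment> \<open>Burnside for the pair of actions on maps and on \<open>X e\<close> produces
      the factor \<open>|\<Gamma>|\<close>, which cancels the denominator because the finite group
      has nonzero order.\<close>
    also have "\<dots> = of_nat (\<Sum>M\<in>R. card (orbits (map_aut_group G M) (X e) (act e)))"
      using burnside_stabilizers[OF maps.group_action_axioms actX fin(2,3) finX R]
        \<open>order (aut_group G) \<noteq> 0\<close>
      by (simp add: map_aut_group_def)
    also have "\<dots> = mfps_nth (\<Sum>M\<in>R. mfps_sum (config_weight G wt) (configurations G Y M)) e"
      by (simp add: mfps_nth_sum sumC)
    finally show "mfps_nth (cpoly_subst (\<lambda>k. mfps_subst_power k (figure_series Y wt)) (imbedding_sum G)) e =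
      mfps_nth (\<Sum>M\<in>R. mfps_sum (config_weight G wt) (configurations G Y M)) e" .
  qed
  moreover have "mfps_summable (config_weight G wt) (configurations G Y M)" if "M \<in> R" for M
    unfolding mfps_summable_def supp[OF that] using finC[OF that] by blast
  moreover have "color_weight G wt c = color_weight G wt d"
    if "M \<in> R" "C \<in> configurations G Y M" "c \<in> C" "d \<in> C" for M C c d
    using WC[OF that(1,2,3)] WC[OF that(1,2,4)] by (simp add: cw)
  ultimately show ?thesis using actM by blast
qed

end
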